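(* Let $G=(V,E)$ be a finite tree with positive edge lengths $\{\alpha_e\}$ and distance matrix $D$, and let $S\subseteq V$ be nonempty. Define $\mathbf{m}\in\mathbb{R}^S$ by $\mathbf{m}_v=\sum_{T\in\mathcal{F}_1(G;S)} w(T)\,(2-\operatorname{outdeg}(T,v))$ for $v\in S$. Then $D[S]\mathbf{m}=\lambda\mathbf{1}$, where \[ \lambda=\sum_{e\in E}\alpha_e\sum_{T\in\mathcal{F}_1(G;S)} w(T) \;-\; \sum_{F\in\mathcal{F}_2(G;S)} w(F)\,\big(2-\operatorname{outdeg}(F,* )\big)^2 . \]
   Context: $D$ has $(u,v)$-entry the sum of $\alpha_e$ along the unique path from $u$ to $v$; $D[S]$ is the principal submatrix indexed by $S$; $\mathbf{1}\in\mathbb{R}^S$ is the all-ones vector. A spanning forest is an acyclic subgraph containing all vertices. $\mathcal{F}_1(G;S)$: spanning forests each of whose components contains exactly one vertex of $S$; for $T\in\mathcal{F}_1(G;S)$ and $v\in S$, $\operatorname{outdeg}(T,v)$ is the number of edges of $G$ with exactly one endpoint in the component of $T$ containing $v$. $\mathcal{F}_2(G;S)$: spanning forests with $|S|+1$ components, $|S|$ of which each contain exactly one vertex of $S$ and one (the floating component $F( * )$) containing none; $\operatorname{outdeg}(F,* )$ is the number of edges of $G$ with exactly one endpoint in $V(F( * ))$. For a subgraph with edge set $A$, $w(A)=\prod_{e\in E\setminus A}\alpha_e$. *)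

theory Defs
  imports Complex_Main
begin

text \<open>
  A simple undirected graph is a vertex set \<open>V\<close> together with a set \<open>E\<close> of two-element
  subsets of \<open>V\<close>. Nothing is lost for trees, which have neither loops nor parallel edges.
\<close>

definition simple_graph :: "'a set \<Rightarrow> 'a set set \<Rightarrow> bool" where
  "simple_graph V E \<longleftrightarrow> (\<forall>e\<in>E. \<exists>u\<in>V. \<exists>v\<in>V. u \<noteq> v \<and> e = {u, v})"

fun walk_edges :: "'a list \<Rightarrow> 'a set list" where
  "walk_edges (x # y # zs) = {x, y} # walk_edges (y # zs)"
| "walk_edges [x] = []"
| "walk_edges [] = []"

definition is_walk :: "'a set \<Rightarrow> 'a set set \<Rightarrow> 'a list \<Rightarrow> bool" where
  "is_walk V E p \<longleftrightarrow> p \<noteq> [] \<and> set p \<subseteq> V \<and> set (walk_edges p) \<subseteq> E"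

definition is_path :: "'a set \<Rightarrow> 'a set set \<Rightarrow> 'a \<Rightarrow> 'a list \<Rightarrow> 'a \<Rightarrow> bool" where
  "is_path V E u p v \<longleftrightarrow> is_walk V E p \<and> distinct p \<and> hd p = u \<and> last p = v"

text \<open>
  A cycle is listed with its starting vertex repeated at the end, so length at least \<open>4\<close>
  means at least three distinct vertices; this excludes walking back and forth along an edge.
\<close>

definition is_cycle :: "'a set \<Rightarrow> 'a set set \<Rightarrow> 'a list \<Rightarrow> bool" where
  "is_cycle V E c \<longleftrightarrow> is_walk V E c \<and> hd c = last c \<and> distinct (tl c) \<and> length c \<ge> 4"

definition acyclic_graph :: "'a set \<Rightarrow> 'a set set \<Rightarrow> bool" where
  "acyclic_graph V E \<longleftrightarrow> (\<nexists>c. is_cycle V E c)"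

definition connected_graph :: "'a set \<Rightarrow> 'a set set \<Rightarrow> bool" where
  "connected_graph V E \<longleftrightarrow> V \<noteq> {} \<and> (\<forall>u\<in>V. \<forall>v\<in>V. \<exists>p. is_path V E u p v)"

definition finite_tree :: "'a set \<Rightarrow> 'a set set \<Rightarrow> bool" where
  "finite_tree V E \<longleftrightarrow>
     finite V \<and> simple_graph V E \<and> connected_graph V E \<and> acyclic_graph V E"

text \<open>Only meaningful where the path from \<open>u\<close> to \<open>v\<close> is unique, as in a tree.\<close>

definition tree_dist :: "'a set \<Rightarrow> 'a set set \<Rightarrow> ('a set \<Rightarrow> real) \<Rightarrow> 'a \<Rightarrow> 'a \<Rightarrow> real" where
  "tree_dist V E \<alpha> u v = sum_list (map \<alpha> (walk_edges (THE p. is_path V E u p v)))"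

definition graph_component :: "'a set \<Rightarrow> 'a set set \<Rightarrow> 'a \<Rightarrow> 'a set" where
  "graph_component V A v = {u. \<exists>p. is_path V A v p u}"

definition graph_components :: "'a set \<Rightarrow> 'a set set \<Rightarrow> 'a set set" where
  "graph_components V A = graph_component V A ` V"

text \<open>
  A subgraph containing all vertices is determined by its edge set, so spanning forests of
  \<open>(V, E)\<close> are represented by their edge sets \<open>A\<close>.
\<close>

definition spanning_forest :: "'a set \<Rightarrow> 'a set set \<Rightarrow> 'a set set \<Rightarrow> bool" where
  "spanning_forest V E A \<longleftrightarrow> A \<subseteq> E \<and> acyclic_graph V A"

definition rooted_forests :: "'a set \<Rightarrow> 'a set set \<Rightarrow> 'a set \<Rightarrow> 'a set set set"
  ("\<F>\<^sub>1") where
  "\<F>\<^sub>1 V E S = {A. spanning_forest V E A \<and> (\<forall>C\<in>graph_components V A. card (C \<inter> S) = 1)}"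

definition floating_forests :: "'a set \<Rightarrow> 'a set set \<Rightarrow> 'a set \<Rightarrow> 'a set set set"
  ("\<F>\<^sub>2") where
  "\<F>\<^sub>2 V E S = {A. spanning_forest V E A \<and>
     card (graph_components V A) = card S + 1 \<and>
     (\<exists>C\<in>graph_components V A. C \<inter> S = {} \<and>
        (\<forall>C'\<in>graph_components V A - {C}. card (C' \<inter> S) = 1))}"

definition floating_component :: "'a set \<Rightarrow> 'a set \<Rightarrow> 'a set set \<Rightarrow> 'a set" where
  "floating_component V S A = (THE C. C \<in> graph_components V A \<and> C \<inter> S = {})"

definition boundary_size :: "'a set set \<Rightarrow> 'a set \<Rightarrow> nat" where
  "boundary_size E C = card {e\<in>E. card (e \<inter> C) = 1}"

definition outdeg :: "'a set \<Rightarrow> 'a set set \<Rightarrow> 'a set set \<Rightarrow> 'a \<Rightarrow> nat" where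
  "outdeg V E T v = boundary_size E (graph_component V T v)"

definition outdeg_floating :: "'a set \<Rightarrow> 'a set set \<Rightarrow> 'a set \<Rightarrow> 'a set set \<Rightarrow> nat" where
  "outdeg_floating V E S F = boundary_size E (floating_component V S F)"

text \<open>The weight is the product over the edges that are \<^emph>\<open>not\<close> in the subgraph.\<close>

definition coweight :: "'a set set \<Rightarrow> ('a set \<Rightarrow> real) \<Rightarrow> 'a set set \<Rightarrow> real" where
  "coweight E \<alpha> A = (\<Prod>e\<in>E - A. \<alpha> e)"

end

theory Submission
  imports Defs
begin

text \<open>
  Give each vertex the mass \<open>2 - deg x\<close>. A component \<open>C\<close> of a spanning forest has total mass
  \<open>2 - |\<partial>C|\<close>, and \<open>\<Sum>x. (2 - deg x) d(u, x) = \<Sum>e. \<alpha> e\<close> for every \<open>u\<close>. Writing \<open>r\<^sub>T x\<close> for the vertex of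
  \<open>S\<close> in the component of \<open>x\<close> in \<open>T\<close>, the claim at \<open>u\<close> reduces to the following identity for each \<open>x\<close>:
  \<open>\<Sum>T. w T (d(u, x) - d(u, r\<^sub>T x)) = \<Sum>F with x in F(*). w F (2 - outdeg(F, *))\<close>.
  Adding and deleting an edge \<open>e\<close> matches pairs \<open>(F, e)\<close> with \<open>e \<in> \<partial>F(*)\<close> and pairs \<open>(T, e)\<close> in which \<open>e\<close>
  separates \<open>x\<close> from \<open>r\<^sub>T x\<close>, at the price of a factor \<open>\<alpha> e\<close>. Exactly one edge of \<open>\<partial>F(*)\<close> separates
  \<open>x\<close> from \<open>u\<close>, so \<open>2 - outdeg(F, *)\<close> is the sum over \<open>e \<in> \<partial>F(*)\<close> of \<open>+1\<close> or \<open>-1\<close> according to whether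
  \<open>e\<close> separates \<open>x\<close> from \<open>u\<close>; under the matching these signs telescope to the difference of distances.
\<close>

section \<open>Connectivity, and the effect of inserting an edge\<close>

text \<open>Connectivity is a closure and not the existence of a path, and it does not mention the
  vertex set: induction along walks and the insertion or deletion of edges then need no care about
  repeated vertices.\<close>

definition conn :: "'a set set \<Rightarrow> 'a \<Rightarrow> 'a \<Rightarrow> bool" where
  "conn A = (\<lambda>x y. {x, y} \<in> A)\<^sup>*\<^sup>*"

lemma conn_refl [simp]: "conn A x x"
  by (simp add: conn_def)

lemma conn_edge: "{x, y} \<in> A \<Longrightarrow> conn A x y"
  by (simp add: conn_def r_into_rtranclp)

lemma conn_trans [trans]: "conn A x y \<Longrightarrow> conn A y z \<Longrightarrow> conn A x z"
  by (simp add: conn_def)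

lemma conn_sym: "conn A x y \<Longrightarrow> conn A y x"
  unfolding conn_def
  by (rule sympD[OF symp_rtranclp]) (auto simp: symp_def insert_commute)

lemma conn_commute: "conn A x y \<longleftrightarrow> conn A y x"
  by (blast intro: conn_sym)

lemma conn_cong_right: "conn A y z \<Longrightarrow> conn A x y \<longleftrightarrow> conn A x z"
  by (meson conn_sym conn_trans)

lemma conn_mono: "A \<subseteq> B \<Longrightarrow> conn A x y \<Longrightarrow> conn B x y"
  unfolding conn_def by (erule rtranclp_mono[THEN predicate2D, rotated]) auto

text \<open>A walk can be shortened until it crosses the new edge at most once, in one of the two
  directions.\<close>

lemma conn_insertD:
  assumes "conn (insert {a, b} A) x y"
  shows "conn A x y \<or> (conn A x a \<and> conn A b y) \<or> (conn A x b \<and> conn A a y)"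
  using assms unfolding conn_def[of "insert {a, b} A"]
proof (induction rule: rtranclp_induct)
  case base
  show ?case by simp
next
  case (step y z)
  from step.hyps(2) consider "{y, z} \<in> A" | "y = a" "z = b" | "y = b" "z = a"
    by (auto simp: doubleton_eq_iff)
  then show ?case
  proof cases
    case 1
    then show ?thesis using step.IH conn_trans[OF _ conn_edge] by metis
  next
    case 2
    then show ?thesis using step.IH by (auto intro: conn_trans)
  next
    case 3
    then show ?thesis using step.IH by (auto intro: conn_trans)
  qed
qed

lemma conn_insert_iff:
  "conn (insert {a, b} A) x y \<longleftrightarrow>
    conn A x y \<or> (conn A x a \<and> conn A b y) \<or> (conn A x b \<and> conn A a y)"
proof
  have ab: "conn (insert {a, b} A) a b" by (simp add: conn_edge)
  have mono: "conn A p q \<Longrightarrow> conn (insert {a, b} A) p q" for p q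
    by (rule conn_mono) auto
  show "conn (insert {a, b} A) x y"
    if "conn A x y \<or> (conn A x a \<and> conn A b y) \<or> (conn A x b \<and> conn A a y)"
    using that mono ab conn_sym[OF ab] conn_trans by metis
qed (rule conn_insertD)

section \<open>Walks, paths and bridges\<close>

lemma walk_edges_append:
  "p \<noteq> [] \<Longrightarrow> q \<noteq> [] \<Longrightarrow>
    walk_edges (p @ q) = walk_edges p @ {last p, hd q} # walk_edges q"
proof (induction p rule: walk_edges.induct)
  case (2 x)
  then show ?case by (cases q) auto
qed auto

lemma walk_edges_subset: "e \<in> set (walk_edges p) \<Longrightarrow> e \<subseteq> set p"
  by (induction p rule: walk_edges.induct) auto

lemma distinct_walk_edges: "distinct p \<Longrightarrow> distinct (walk_edges p)"
  by (induction p rule: walk_edges.induct) (auto dest: walk_edges_subset)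

lemma walk_conn: "p \<noteq> [] \<Longrightarrow> set (walk_edges p) \<subseteq> A \<Longrightarrow> conn A (hd p) (last p)"
proof (induction p rule: walk_edges.induct)
  case (1 x y zs)
  then show ?case by (auto intro: conn_trans[OF conn_edge])
qed auto

text \<open>The path is built backwards from \<open>y\<close>. If the vertex to be prepended already
  occurs, the loop is cut off by keeping only the part of the path from that vertex on.\<close>

lemma conn_imp_path:
  assumes "conn A x y" "y \<in> V" "\<Union>A \<subseteq> V"
  shows "\<exists>p. is_path V A x p y"
  using assms(1) unfolding conn_def
proof (induction rule: converse_rtranclp_induct)
  case base
  have "is_path V A y [y] y" using assms(2) by (simp add: is_path_def is_walk_def)
  then show ?case ..
next
  case (step x z)
  then obtain p where p: "is_path V A z p y" by blast
  show ?case
  proof (cases "x \<in> set p")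
    case False
    from p obtain q where "p = z # q"
      by (cases p) (auto simp: is_path_def is_walk_def)
    then have "is_path V A x (x # p) y"
      using p False step.hyps(1) assms(3) by (auto simp: is_path_def is_walk_def)
    then show ?thesis ..
  next
    case True
    then obtain xs ys where split: "p = xs @ x # ys" by (auto dest: split_list)
    then have "set (walk_edges (x # ys)) \<subseteq> set (walk_edges p)"
      by (cases "xs = []") (auto simp: walk_edges_append)
    then have "is_path V A x (x # ys) y"
      using p split by (auto simp: is_path_def is_walk_def)
    then show ?thesis ..
  qed
qed

lemma graph_component_eq:
  assumes "\<Union>A \<subseteq> V" "v \<in> V"
  shows "graph_component V A v = {u \<in> V. conn A v u}"
proof
  show "graph_component V A v \<subseteq> {u \<in> V. conn A v u}"
    using walk_conn by (fastforce simp: graph_component_def is_path_def is_walk_def)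
  show "{u \<in> V. conn A v u} \<subseteq> graph_component V A v"
    using conn_imp_path assms by (fastforce simp: graph_component_def)
qed

text \<open>A path from \<open>a\<close> to \<open>b\<close> without the edge \<open>{a, b}\<close>
  has an inner vertex, so closing it with that edge gives the cycle \<open>b # p\<close> of length
  at least 4.\<close>

lemma acyclic_bridge:
  assumes "acyclic_graph V A" "\<Union>A \<subseteq> V" "{a, b} \<in> A" "a \<noteq> b"
  shows "\<not> conn (A - {{a, b}}) a b"
proof
  assume "conn (A - {{a, b}}) a b"
  moreover have "b \<in> V" "\<Union>(A - {{a, b}}) \<subseteq> V" using assms by auto
  ultimately obtain p where p: "is_path V (A - {{a, b}}) a p b"
    using conn_imp_path by metis
  then obtain y zs where "p = a # y # zs"
    using assms(4) by (cases p; cases "tl p") (auto simp: is_path_def is_walk_def)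
  moreover from this p have "zs \<noteq> []"
    by (auto simp: is_path_def is_walk_def)
  ultimately have "is_cycle V A (b # p)"
    using p assms by (cases zs)
      (auto simp: is_cycle_def is_path_def is_walk_def insert_commute)
  then show False using assms(1) by (auto simp: acyclic_graph_def)
qed

section \<open>Edge cuts, paths and distances in a tree\<close>

locale tree_graph =
  fixes V :: "'a set" and E :: "'a set set"
  assumes tree: "finite_tree V E"
begin

text \<open>For a tree edge \<open>e\<close> and vertices \<open>x\<close>, \<open>y\<close> this
  says that \<open>e\<close> lies on the path between them (\<open>path_edges_sep\<close>).
  Formulated by deletion, it is the complement of an equivalence relation with two classes.\<close>

definition sep :: "'a set \<Rightarrow> 'a \<Rightarrow> 'a \<Rightarrow> bool" where
  "sep e x y \<longleftrightarrow> \<not> conn (E - {e}) x y"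

definition edge_boundary :: "'a set \<Rightarrow> 'a set set" where
  "edge_boundary C = {e \<in> E. card (e \<inter> C) = 1}"

lemma boundary_size_eq: "boundary_size E C = card (edge_boundary C)"
  by (simp add: boundary_size_def edge_boundary_def)

lemma finite_V: "finite V"
  using tree by (simp add: finite_tree_def)

lemma edgeE:
  assumes "e \<in> E"
  obtains a b where "a \<in> V" "b \<in> V" "a \<noteq> b" "e = {a, b}"
  using tree assms by (auto simp: finite_tree_def simple_graph_def)

lemma edges_subset:
  assumes "A \<subseteq> E"
  shows "\<Union>A \<subseteq> V"
proof (rule Union_least)
  fix e assume "e \<in> A"
  then have "e \<in> E" using assms by blast
  then show "e \<subseteq> V" by (rule edgeE) simp
qed

lemma finite_E: "finite E"
  by (rule finite_UnionD, rule finite_subset[OF edges_subset[OF order_refl] finite_V])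

lemma connected: "x \<in> V \<Longrightarrow> y \<in> V \<Longrightarrow> conn E x y"
  using tree walk_conn[of _ E]
  unfolding finite_tree_def connected_graph_def is_path_def is_walk_def by metis

lemma edge_boundary_iff:
  "{p, q} \<in> edge_boundary C \<longleftrightarrow> {p, q} \<in> E \<and> (p \<in> C \<longleftrightarrow> q \<notin> C)"
proof (cases "p = q")
  case True
  moreover have "{p} \<notin> E"
  proof
    assume "{p} \<in> E"
    then obtain a b where "a \<noteq> b" "{p} = {a, b}" by (rule edgeE)
    then show False by auto
  qed
  ultimately show ?thesis by (simp add: edge_boundary_def)
qed (auto simp: edge_boundary_def Int_insert_left)

lemma component_edge_boundary:
  assumes "e \<in> A" "A \<subseteq> E"
  shows "e \<notin> edge_boundary {y. conn A x y}"
proof -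
  obtain p q where e: "e = {p, q}" using assms edgeE[of e] by blast
  then have "conn A x p \<longleftrightarrow> conn A x q"
    using conn_cong_right conn_edge assms(1) by metis
  then show ?thesis by (simp add: e edge_boundary_iff)
qed

lemma conn_in_V:
  assumes "A \<subseteq> E" "conn A x y" "x \<in> V"
  shows "y \<in> V"
  using assms(2) unfolding conn_def
  by (induction rule: rtranclp_induct) (use assms edges_subset[OF assms(1)] in auto)

lemma finite_conn: "A \<subseteq> E \<Longrightarrow> v \<in> V \<Longrightarrow> finite {x. conn A v x}"
  by (rule finite_subset[OF _ finite_V]) (auto intro: conn_in_V)

lemma acyclic_subset: "A \<subseteq> E \<Longrightarrow> acyclic_graph V A"
  using tree order_trans[of _ A E]
  unfolding finite_tree_def acyclic_graph_def is_cycle_def is_walk_def by metis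

lemma spanning_forest_iff: "spanning_forest V E A \<longleftrightarrow> A \<subseteq> E"
  using acyclic_subset by (auto simp: spanning_forest_def)

lemma component_eq: "A \<subseteq> E \<Longrightarrow> v \<in> V \<Longrightarrow> graph_component V A v = {u. conn A v u}"
  using graph_component_eq[OF edges_subset] conn_in_V by blast

text \<open>Every edge of a tree is a bridge: by monotonicity it suffices to look at
  \<open>E - {{a, b}}\<close>, where \<open>acyclic_bridge\<close> applies.\<close>

lemma edge_nonconn:
  assumes "A \<subseteq> E" "{a, b} \<in> E" "{a, b} \<notin> A"
  shows "\<not> conn A a b"
proof
  assume "conn A a b"
  then have "conn (E - {{a, b}}) a b" using assms by (auto intro: conn_mono[rotated])
  moreover have "a \<noteq> b" using assms(2) by (auto elim: edgeE)
  ultimately show False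
    using acyclic_bridge[OF acyclic_subset edges_subset] assms(2) by blast
qed

lemma sep_sym: "sep e x y \<longleftrightarrow> sep e y x"
  by (simp add: sep_def conn_commute)

text \<open>Putting the edge back restores the connected tree, so a walk from \<open>x\<close> to
  \<open>a\<close> either avoids the edge or reaches \<open>b\<close> before crossing it.\<close>

lemma sep_endpoint:
  assumes "{a, b} \<in> E" "x \<in> V"
  shows "conn (E - {{a, b}}) x a \<or> conn (E - {{a, b}}) x b"
proof -
  have "insert {a, b} (E - {{a, b}}) = E" using assms(1) by auto
  moreover have "conn E x a"
    using assms edges_subset[OF order_refl] by (auto intro: connected)
  ultimately show ?thesis
    using conn_insertD[of a b "E - {{a, b}}" x a] by auto
qed

text \<open>Deleting \<open>e\<close> leaves only two sides, so two vertices that are both opposite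
  to \<open>x\<close> share a side.\<close>

lemma sep_two_sides:
  assumes "e \<in> E" "x \<in> V" "y \<in> V" "z \<in> V" "sep e x y" "sep e x z"
  shows "\<not> sep e y z"
proof -
  obtain a b where e: "e = {a, b}" using assms(1) by (rule edgeE)
  then have "conn (E - {e}) w a \<or> conn (E - {e}) w b" if "w \<in> V" for w
    using sep_endpoint assms(1) that by simp
  from this[OF assms(2)] this[OF assms(3)] this[OF assms(4)] show ?thesis
    using assms(5,6) unfolding sep_def by (meson conn_sym conn_trans)
qed

text \<open>A path missing \<open>e\<close> witnesses that \<open>e\<close> does not separate its
  ends. Conversely, a path through \<open>e\<close> falls into two pieces that avoid
  \<open>e\<close>, which tie \<open>u\<close> and \<open>v\<close> to the two ends of a
  bridge.\<close>

lemma path_edges_sep: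
  assumes "is_path V E u p v"
  shows "set (walk_edges p) = {e \<in> E. sep e u v}"
proof (intro set_eqI iffI)
  fix e assume "e \<in> {e \<in> E. sep e u v}"
  then show "e \<in> set (walk_edges p)"
    using assms walk_conn[of p "E - {e}"]
    by (auto simp: sep_def is_path_def is_walk_def)
next
  fix e assume e: "e \<in> set (walk_edges p)"
  have "\<exists>p1 p2. p = p1 @ p2 \<and> p1 \<noteq> [] \<and> p2 \<noteq> [] \<and> e = {last p1, hd p2}"
    using e
  proof (induction p rule: walk_edges.induct)
    case (1 x y zs)
    show ?case
    proof (cases "e = {x, y}")
      case True
      then show ?thesis by (intro exI[of _ "[x]"] exI[of _ "y # zs"]) auto
    next
      case False
      with 1 obtain p1 p2 where
        "y # zs = p1 @ p2" "p1 \<noteq> []" "p2 \<noteq> []" "e = {last p1, hd p2}" by auto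
      then show ?thesis by (intro exI[of _ "x # p1"] exI[of _ p2]) auto
    qed
  qed auto
  then obtain p1 p2 where p: "p = p1 @ p2" "p1 \<noteq> []" "p2 \<noteq> []" "e = {last p1, hd p2}"
    by blast
  then have w: "walk_edges p = walk_edges p1 @ e # walk_edges p2"
    by (simp add: walk_edges_append)
  have "distinct (walk_edges p)"
    using assms by (auto simp: is_path_def intro: distinct_walk_edges)
  then have sub: "set (walk_edges p1) \<subseteq> E - {e}" "set (walk_edges p2) \<subseteq> E - {e}" "e \<in> E"
    using assms w by (auto simp: is_path_def is_walk_def)
  have "hd p1 = u" "last p2 = v" using assms p by (auto simp: is_path_def)
  then have "conn (E - {e}) u (last p1)" "conn (E - {e}) (hd p2) v"
    using walk_conn[OF p(2) sub(1)] walk_conn[OF p(3) sub(2)] by auto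
  moreover have "\<not> conn (E - {e}) (last p1) (hd p2)"
    using edge_nonconn[of "E - {e}"] p(4) sub(3) by auto
  ultimately have "sep e u v"
    unfolding sep_def by (meson conn_sym conn_trans)
  then show "e \<in> {e \<in> E. sep e u v}" using sub by simp
qed

text \<open>Both paths have the separating edges as their edge set. Since \<open>u\<close> does not
  reappear, each path has just one edge at \<open>u\<close>, so the second vertices agree and
  induction applies to the tails.\<close>

lemma path_unique: "is_path V E u p v \<Longrightarrow> is_path V E u q v \<Longrightarrow> p = q"
proof (induction p arbitrary: u q)
  case Nil
  then show ?case by (simp add: is_path_def is_walk_def)
next
  case (Cons x p)
  then have x: "x = u" by (simp add: is_path_def)
  obtain q' where q: "q = u # q'"
    using Cons.prems(2) by (cases q) (auto simp: is_path_def is_walk_def)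
  show ?case
  proof (cases "p = [] \<or> q' = []")
    case True
    then show ?thesis using Cons.prems q x
      by (auto simp: is_path_def split: if_splits)
  next
    case False
    then obtain y ps z qs where ps: "p = y # ps" "q' = z # qs" by (meson neq_Nil_conv)
    have paths: "is_path V E y p v" "is_path V E z q' v"
      using Cons.prems x q ps by (auto simp: is_path_def is_walk_def)
    have "set (walk_edges (x # p)) = set (walk_edges q)"
      using Cons.prems path_edges_sep by blast
    moreover have "\<forall>e \<in> set (walk_edges q'). u \<notin> e"
      using Cons.prems q walk_edges_subset by (fastforce simp: is_path_def)
    moreover have "{u, y} \<in> set (walk_edges (x # p))" using x ps by simp
    ultimately have "{u, y} = {u, z}" using q ps by auto
    then have "y = z" by (auto simp: doubleton_eq_iff)
    then show ?thesis using Cons.IH paths x q by blast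
  qed
qed

text \<open>The cut form of the distance is linear in the edges, so that later sums over vertices
  can be evaluated one edge at a time.\<close>

lemma tree_dist_eq:
  assumes "u \<in> V" "v \<in> V"
  shows "tree_dist V E \<alpha> u v = (\<Sum>e\<in>E. \<alpha> e * of_bool (sep e u v))"
proof -
  obtain p where p: "is_path V E u p v"
    using tree assms by (auto simp: finite_tree_def connected_graph_def)
  then have the: "(THE p. is_path V E u p v) = p" using path_unique by blast
  have "distinct (walk_edges p)" using p distinct_walk_edges[of p] by (simp add: is_path_def)
  then have "tree_dist V E \<alpha> u v = (\<Sum>e\<in>{e \<in> E. sep e u v}. \<alpha> e)"
    by (simp add: tree_dist_def the sum_list_distinct_conv_sum_set path_edges_sep[OF p])
  also have "\<dots> = (\<Sum>e\<in>E. \<alpha> e * of_bool (sep e u v))"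
    by (intro sum.mono_neutral_cong_left finite_E) auto
  finally show ?thesis .
qed

section \<open>Vertex masses and component boundaries\<close>

definition vertex_mass :: "'a \<Rightarrow> real" where
  "vertex_mass x = 2 - real (card {e \<in> E. x \<in> e})"

text \<open>Double counting of incidences.\<close>

lemma sum_degree:
  assumes "finite C" "A \<subseteq> E"
  shows "(\<Sum>x\<in>C. real (card {e \<in> A. x \<in> e})) = (\<Sum>e\<in>A. real (card (e \<inter> C)))"
proof -
  have fin: "finite A" using assms finite_E finite_subset by blast
  have "(\<Sum>x\<in>C. real (card {e \<in> A. x \<in> e})) = (\<Sum>x\<in>C. \<Sum>e\<in>A. of_bool (x \<in> e))"
    using fin by (simp add: Int_def of_bool_def if_distrib sum.If_cases)
  also have "\<dots> = (\<Sum>e\<in>A. \<Sum>x\<in>C. of_bool (x \<in> e))" by (rule sum.swap)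
  also have "\<dots> = (\<Sum>e\<in>A. real (card (e \<inter> C)))"
    using assms(1) by (simp add: Int_commute)
  finally show ?thesis .
qed

text \<open>A tree on \<open>n\<close> vertices has degree sum \<open>2 * (n - 1)\<close>. The
  induction inserts the edges one by one instead of counting them.\<close>

lemma sum_forest_mass:
  assumes "A \<subseteq> E" "v \<in> V"
  shows "(\<Sum>x | conn A v x. 2 - real (card {e \<in> A. x \<in> e})) = 2"
proof -
  have "finite A" using assms finite_E finite_subset by blast
  then show ?thesis using assms
  proof (induction A arbitrary: v rule: finite_induct)
    case empty
    have "{x. conn {} v x} = {v}" by (auto simp: conn_def elim: converse_rtranclpE)
    then show ?case by simp
  next
    case (insert e A)
    then obtain a b where ab: "a \<in> V" "b \<in> V" "a \<noteq> b" "e = {a, b}" by (auto elim: edgeE)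
    let ?f = "\<lambda>B x. 2 - real (card {e \<in> B. x \<in> e})"
    let ?K = "\<lambda>B v. {x. conn B v x}"
    have A: "A \<subseteq> E" using insert by auto
    have fin: "finite (?K A v)" if "v \<in> V" for v
      using A that by (rule finite_conn)
    have f: "?f (insert e A) x = ?f A x - of_bool (x \<in> e)" for x
    proof -
      have "{e' \<in> insert e A. x \<in> e'} = (if x \<in> e then insert e {e' \<in> A. x \<in> e'} else {e' \<in> A. x \<in> e'})"
        by auto
      then show ?thesis using insert.hyps by auto
    qed
    have nc: "\<not> conn A a b"
      using edge_nonconn[OF A, of a b] insert ab by auto
    show ?case
    proof (cases "conn A v a \<or> conn A v b")
      case False
      then have K: "?K (insert e A) v = ?K A v"
        using ab by (auto simp: conn_insert_iff)
      show ?thesis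
        unfolding K f using insert.IH[OF A insert.prems(2)] False ab
        by (simp add: sum_subtractf) (auto intro!: sum.neutral)
    next
      case True
      \<comment> \<open>The components of \<open>a\<close> and \<open>b\<close> merge: their masses
        add up to 4, and the new edge takes away 1 at each end.\<close>
      then have K: "?K (insert e A) v = ?K A a \<union> ?K A b"
        unfolding ab(4) conn_insert_iff by (auto intro: conn_trans conn_sym)
      have disj: "?K A a \<inter> ?K A b = {}"
        using nc by (auto dest: conn_sym conn_trans)
      have inter: "(?K A a \<union> ?K A b) \<inter> e = {a, b}" using ab by auto
      have "(\<Sum>x\<in>?K A a \<union> ?K A b. of_bool (x \<in> e)) = real (card ((?K A a \<union> ?K A b) \<inter> e))"
        using fin[OF ab(1)] fin[OF ab(2)] by simp
      also have "\<dots> = 2" unfolding inter using ab by simp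
      finally have two: "(\<Sum>x\<in>?K A a \<union> ?K A b. of_bool (x \<in> e)) = (2::real)" .
      then show ?thesis
        unfolding K f sum_subtractf[of _ "\<lambda>x. of_bool (x \<in> e)"] two
        using insert.IH[OF A] ab(1,2) fin disj by (subst sum.union_disjoint) auto
    qed
  qed
qed

text \<open>The edges of \<open>A\<close> account for the 2 by \<open>sum_forest_mass\<close>. Any
  other edge has at most one end in the component, as both ends would close a cycle, so the
  remaining degrees count the boundary.\<close>

lemma sum_vertex_mass:
  assumes "A \<subseteq> E" "v \<in> V"
  shows "(\<Sum>x | conn A v x. vertex_mass x) = 2 - real (boundary_size E {x. conn A v x})"
proof -
  let ?C = "{x. conn A v x}"
  have fin: "finite ?C" using assms by (rule finite_conn)
  have deg: "card {e \<in> E. x \<in> e} = card {e \<in> A. x \<in> e} + card {e \<in> E - A. x \<in> e}" for x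
  proof -
    have "{e \<in> E. x \<in> e} = {e \<in> A. x \<in> e} \<union> {e \<in> E - A. x \<in> e}"
      using assms by auto
    moreover have "finite {e \<in> A. x \<in> e}" "finite {e \<in> E - A. x \<in> e}"
      using finite_E finite_subset[OF assms(1)] by auto
    ultimately show ?thesis by (auto intro: card_Un_disjoint)
  qed
  have single: "card (e \<inter> ?C) = of_bool (e \<in> edge_boundary ?C)" if e: "e \<in> E - A" for e
  proof -
    obtain a b where ab: "a \<noteq> b" "e = {a, b}" using e by (auto elim: edgeE)
    then have "\<not> (conn A v a \<and> conn A v b)"
      using edge_nonconn[OF assms(1), of a b] e by (auto dest: conn_sym conn_trans)
    then have "card (e \<inter> ?C) \<le> 1"
      using ab by (auto simp: Int_insert_left)
    then show ?thesis using e by (auto simp: edge_boundary_def)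
  qed
  \<comment> \<open>Edges of \<open>A\<close> are never on the boundary, so restricting to
    \<open>E - A\<close> loses no boundary edge.\<close>
  have "(E - A) \<inter> edge_boundary ?C = edge_boundary ?C"
    using component_edge_boundary[OF _ assms(1)] by (auto simp: edge_boundary_def)
  then have "(\<Sum>e\<in>E - A. real (card (e \<inter> ?C))) = boundary_size E ?C"
    using single finite_E by (simp add: boundary_size_eq)
  then have "(\<Sum>x\<in>?C. real (card {e \<in> E - A. x \<in> e})) = boundary_size E ?C"
    using sum_degree[OF fin, of "E - A"] by simp
  then show ?thesis
    using sum_forest_mass[OF assms]
    by (simp add: vertex_mass_def deg sum_subtractf sum.distrib algebra_simps)
qed

text \<open>The side of \<open>e\<close> away from \<open>u\<close> is a component of
  \<open>E - {e}\<close> with boundary \<open>{e}\<close>, hence has mass \<open>2 - 1 = 1\<close>.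
  Each edge therefore contributes exactly its length.\<close>

lemma sum_vertex_mass_dist:
  assumes "u \<in> V"
  shows "(\<Sum>x\<in>V. vertex_mass x * tree_dist V E \<alpha> u x) = (\<Sum>e\<in>E. \<alpha> e)"
proof -
  have side: "(\<Sum>x\<in>V. vertex_mass x * of_bool (sep e u x)) = 1" if e: "e \<in> E" for e
  proof -
    \<comment> \<open>The edge is oriented so that \<open>a\<close> is on the side of
      \<open>u\<close>; the far side is then the component of \<open>b\<close>.\<close>
    obtain a b where ab: "a \<in> V" "b \<in> V" "a \<noteq> b" "e = {a, b}" "\<not> sep e u a"
    proof -
      obtain a b where e': "a \<in> V" "b \<in> V" "a \<noteq> b" "e = {a, b}" using e by (rule edgeE)
      then consider "\<not> sep e u a" | "\<not> sep e u b"
        using sep_endpoint[of a b u] e assms by (auto simp: sep_def)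
      then show ?thesis
        using that[of a b] that[of b a] e' by cases (auto simp: insert_commute)
    qed
    have nc: "\<not> conn (E - {e}) a b"
      using edge_nonconn[of "E - {e}" a b] e ab by auto
    have far: "sep e u x \<longleftrightarrow> conn (E - {e}) b x" if "x \<in> V" for x
      using nc ab(5) sep_endpoint[of a b x] that e ab(4) unfolding sep_def
      by (metis conn_sym conn_trans)
    have "V \<inter> {x. sep e u x} = {x. conn (E - {e}) b x}"
      using far conn_in_V[of "E - {e}" b] ab by auto
    then have "(\<Sum>x\<in>V. vertex_mass x * of_bool (sep e u x)) =
        (\<Sum>x | conn (E - {e}) b x. vertex_mass x)"
      using finite_V by (simp add: of_bool_def if_distrib sum.If_cases)
    also have "\<dots> = 2 - real (card (edge_boundary {x. conn (E - {e}) b x}))"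
      using sum_vertex_mass[of "E - {e}" b] ab by (simp add: boundary_size_eq)
    also have "edge_boundary {x. conn (E - {e}) b x} = {e}"
    proof -
      have "e' = e" if "e' \<in> edge_boundary {x. conn (E - {e}) b x}" for e'
        using that component_edge_boundary[of e' "E - {e}" b] by (auto simp: edge_boundary_def)
      moreover have "e \<in> edge_boundary {x. conn (E - {e}) b x}"
        using e ab nc by (simp add: edge_boundary_iff conn_commute)
      ultimately show ?thesis by blast
    qed
    finally show ?thesis by simp
  qed
  have "(\<Sum>x\<in>V. vertex_mass x * tree_dist V E \<alpha> u x) =
      (\<Sum>x\<in>V. \<Sum>e\<in>E. \<alpha> e * (vertex_mass x * of_bool (sep e u x)))"
    using assms by (simp add: tree_dist_eq sum_distrib_left mult.left_commute)
  also have "\<dots> = (\<Sum>e\<in>E. \<alpha> e * (\<Sum>x\<in>V. vertex_mass x * of_bool (sep e u x)))"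
    by (subst sum.swap) (simp add: sum_distrib_left)
  finally show ?thesis by (simp add: side)
qed

text \<open>Walking from \<open>x\<close> to \<open>u\<close>, the edge of the last exit from the
  component separates them. Any other boundary edge is avoided by a walk inside the component,
  across that edge, and then outside.\<close>

lemma unique_separating_boundary_edge:
  assumes "A \<subseteq> E" "x \<in> V" "u \<in> V" "\<not> conn A x u"
  shows "\<exists>!e. e \<in> edge_boundary {y. conn A x y} \<and> sep e x u"
proof -
  let ?C = "{y. conn A x y}"
  let ?B = "edge_boundary ?C"
  \<comment> \<open>Induction along the walk remembers the last exit \<open>{a, b}\<close>: since
    then no boundary edge has been used.\<close>
  have exit: "y \<in> ?C \<or> (\<exists>a b. a \<in> ?C \<and> b \<notin> ?C \<and> {a, b} \<in> E \<and> conn (E - ?B) b y)"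
    if "conn E x y" for y
    using that unfolding conn_def[of E]
  proof (induction rule: rtranclp_induct)
    case base
    show ?case by simp
  next
    case (step y z)
    consider "z \<in> ?C" | "y \<in> ?C" "z \<notin> ?C" | "y \<notin> ?C" "z \<notin> ?C" by blast
    then show ?case
    proof cases
      case 2
      then show ?thesis using step.hyps(2) by (metis conn_refl)
    next
      case 3
      then have "conn (E - ?B) y z" using step.hyps(2) edge_boundary_iff by (auto intro: conn_edge)
      then show ?thesis using 3 step.IH by (metis conn_trans)
    qed simp
  qed
  then obtain a b where ab: "a \<in> ?C" "b \<notin> ?C" "{a, b} \<in> E" "conn (E - ?B) b u"
    using connected assms by blast
  have AB: "A \<subseteq> E - ?B"
    using component_edge_boundary assms(1) by blast
  have xa: "conn (E - {e}) x a" and bu: "conn (E - {e}) b u" if "e \<in> ?B" for e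
    using that AB ab by (auto elim!: conn_mono[rotated])
  show ?thesis
  proof (rule ex1I[of _ "{a, b}"])
    have "{a, b} \<in> ?B" using ab edge_boundary_iff by auto
    moreover have "\<not> conn (E - {{a, b}}) a b" using edge_nonconn ab by blast
    ultimately show "{a, b} \<in> ?B \<and> sep {a, b} x u"
      using xa bu unfolding sep_def by (meson conn_sym conn_trans)
  next
    fix e assume e: "e \<in> ?B \<and> sep e x u"
    show "e = {a, b}"
    proof (rule ccontr)
      assume "e \<noteq> {a, b}"
      then have "conn (E - {e}) a b" using ab by (auto intro: conn_edge)
      then show False using xa bu e unfolding sep_def by (meson conn_trans)
    qed
  qed
qed

end

section \<open>Rooted forests and forests with a floating component\<close>

locale rooted_tree_graph = tree_graph +
  fixes S :: "'a set"
  assumes S_subset: "S \<subseteq> V"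
begin

definition root :: "'a set set \<Rightarrow> 'a \<Rightarrow> 'a" where
  "root T x = (THE s. s \<in> S \<and> conn T x s)"

text \<open>For \<open>x\<close> in \<open>V\<close>: \<open>A\<close> belongs to
  \<open>\<F>\<^sub>2\<close> and \<open>x\<close> lies in its floating component
  (\<open>floating_at_iff\<close>). The condition is imposed vertex by vertex, without counting
  components.\<close>

definition floating_at :: "'a set set \<Rightarrow> 'a \<Rightarrow> bool" where
  "floating_at A x \<longleftrightarrow> A \<subseteq> E \<and> (\<forall>s\<in>S. \<not> conn A x s) \<and>
    (\<forall>y\<in>V. conn A x y \<or> (\<exists>!s. s \<in> S \<and> conn A y s))"

lemma card_component_eq_1:
  assumes "A \<subseteq> E" "y \<in> V"
  shows "card (graph_component V A y \<inter> S) = 1 \<longleftrightarrow> (\<exists>!s. s \<in> S \<and> conn A y s)"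
  unfolding component_eq[OF assms] One_nat_def card_1_singleton_iff set_eq_iff
  by (simp add: Ex1_def conj_commute) metis

lemma rooted_forests_iff:
  "T \<in> \<F>\<^sub>1 V E S \<longleftrightarrow> T \<subseteq> E \<and> (\<forall>x\<in>V. \<exists>!s. s \<in> S \<and> conn T x s)"
  by (cases "T \<subseteq> E")
    (simp_all add: rooted_forests_def spanning_forest_iff graph_components_def
      card_component_eq_1[unfolded One_nat_def])

lemma root:
  assumes "T \<in> \<F>\<^sub>1 V E S" "x \<in> V"
  shows "root T x \<in> S" "conn T x (root T x)"
proof -
  have "\<exists>!s. s \<in> S \<and> conn T x s" using assms by (simp add: rooted_forests_iff)
  from theI'[OF this] show "root T x \<in> S" "conn T x (root T x)"
    by (simp_all add: root_def)
qed

lemma root_eq: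
  assumes "T \<in> \<F>\<^sub>1 V E S" "x \<in> V" "s \<in> S" "conn T x s"
  shows "root T x = s"
proof -
  have "\<exists>!s. s \<in> S \<and> conn T x s" using assms by (simp add: rooted_forests_iff)
  then show ?thesis using assms(3,4) by (simp add: root_def the1_equality)
qed

text \<open>No two vertices of \<open>S\<close> are connected, since each is the only vertex of
  \<open>S\<close> in its component. The components of \<open>S\<close> are thus distinct, and the
  one of \<open>x\<close> is the single extra one.\<close>

lemma floating_components:
  assumes "floating_at A x" "x \<in> V"
  shows "graph_components V A = insert (graph_component V A x) (graph_component V A ` S)"
    and "card (graph_components V A) = card S + 1"
proof -
  have A: "A \<subseteq> E" using assms(1) by (simp add: floating_at_def)
  have eq: "graph_component V A y = graph_component V A z" if "conn A y z" "y \<in> V" for y z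
    using that conn_in_V[OF A that] conn_cong_right[OF that(1)]
    by (simp add: component_eq A conn_commute)
  have eqD: "conn A y z" if "graph_component V A y = graph_component V A z" "y \<in> V" "z \<in> V" for y z
    using that by (auto simp: component_eq A set_eq_iff)
  show comps: "graph_components V A = insert (graph_component V A x) (graph_component V A ` S)"
  proof
    show "graph_components V A \<subseteq> insert (graph_component V A x) (graph_component V A ` S)"
    proof
      fix C assume "C \<in> graph_components V A"
      then obtain y where y: "y \<in> V" "C = graph_component V A y"
        by (auto simp: graph_components_def)
      consider "conn A x y" | s where "s \<in> S" "conn A y s"
        using assms(1) y(1) unfolding floating_at_def by blast
      then show "C \<in> insert (graph_component V A x) (graph_component V A ` S)"
        using eq[of x y] eq[of y] y assms(2) by cases auto
    qed
    show "insert (graph_component V A x) (graph_component V A ` S) \<subseteq> graph_components V A"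
      using assms(2) S_subset by (auto simp: graph_components_def)
  qed
  have "inj_on (graph_component V A) S"
  proof (rule inj_onI)
    fix s t assume st: "s \<in> S" "t \<in> S" "graph_component V A s = graph_component V A t"
    then have "conn A s t" using eqD S_subset by blast
    then show "s = t"
      using st(1,2) assms(1) S_subset conn_refl[of A s] unfolding floating_at_def by (metis subsetD)
  qed
  moreover have "graph_component V A x \<notin> graph_component V A ` S"
    using eqD[of x] assms S_subset by (auto simp: floating_at_def)
  moreover have "finite S" using S_subset finite_V by (rule finite_subset)
  ultimately show "card (graph_components V A) = card S + 1"
    by (simp add: comps card_image)
qed

lemma floating_forests_iff: "A \<in> \<F>\<^sub>2 V E S \<longleftrightarrow> (\<exists>x\<in>V. floating_at A x)"
proof
  assume "A \<in> \<F>\<^sub>2 V E S"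
  then obtain x where x: "A \<subseteq> E" "x \<in> V" "graph_component V A x \<inter> S = {}"
    "\<And>y. y \<in> V \<Longrightarrow> graph_component V A y \<noteq> graph_component V A x \<Longrightarrow>
      card (graph_component V A y \<inter> S) = 1"
    by (auto simp: floating_forests_def spanning_forest_iff graph_components_def)
  have "conn A x y \<or> (\<exists>!s. s \<in> S \<and> conn A y s)" if "y \<in> V" for y
  proof (cases "graph_component V A y = graph_component V A x")
    case True
    then have "conn A x y" using x that by (auto simp: component_eq set_eq_iff)
    then show ?thesis ..
  next
    case False
    then show ?thesis using x that card_component_eq_1 by blast
  qed
  then have "floating_at A x"
    using x by (auto simp: floating_at_def component_eq)
  then show "\<exists>x\<in>V. floating_at A x" using x by blast
next
  assume "\<exists>x\<in>V. floating_at A x"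
  then obtain x where x: "x \<in> V" "floating_at A x" by blast
  then have A: "A \<subseteq> E" by (simp add: floating_at_def)
  have "card (C \<inter> S) = 1" if C: "C \<in> graph_components V A - {graph_component V A x}" for C
  proof -
    obtain s where s: "s \<in> S" "C = graph_component V A s"
      using C floating_components(1)[OF x(2,1)] by auto
    then have "\<exists>!t. t \<in> S \<and> conn A s t"
      using x S_subset unfolding floating_at_def by blast
    then show ?thesis using s card_component_eq_1[OF A] S_subset by blast
  qed
  moreover have "graph_component V A x \<inter> S = {}"
    using x A by (auto simp: component_eq floating_at_def)
  moreover have "graph_component V A x \<in> graph_components V A"
    using x by (simp add: graph_components_def)
  ultimately show "A \<in> \<F>\<^sub>2 V E S"
    using floating_components(2)[OF x(2,1)] A
    unfolding floating_forests_def spanning_forest_iff by blast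
qed

lemma floating_component_eq:
  assumes "floating_at A x" "x \<in> V"
  shows "floating_component V S A = {y. conn A x y}"
  unfolding floating_component_def
proof (rule the_equality)
  have A: "A \<subseteq> E" using assms(1) by (simp add: floating_at_def)
  have x: "graph_component V A x = {y. conn A x y}" using component_eq A assms(2) .
  show "{y. conn A x y} \<in> graph_components V A \<and> {y. conn A x y} \<inter> S = {}"
    using assms x by (auto simp: graph_components_def floating_at_def)
  fix C assume C: "C \<in> graph_components V A \<and> C \<inter> S = {}"
  moreover have "s \<in> graph_component V A s" if "s \<in> S" for s
    using that S_subset A by (auto simp: component_eq)
  ultimately show "C = {y. conn A x y}"
    using floating_components(1)[OF assms] x by blast
qed

lemma floating_at_iff:
  assumes "x \<in> V"
  shows "floating_at A x \<longleftrightarrow> A \<in> \<F>\<^sub>2 V E S \<and> x \<in> floating_component V S A"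
proof
  assume "floating_at A x"
  then show "A \<in> \<F>\<^sub>2 V E S \<and> x \<in> floating_component V S A"
    using assms floating_component_eq floating_forests_iff by auto
next
  assume A: "A \<in> \<F>\<^sub>2 V E S \<and> x \<in> floating_component V S A"
  then obtain y where y: "y \<in> V" "floating_at A y" using floating_forests_iff by blast
  then have "conn A y x" using A floating_component_eq by blast
  \<comment> \<open>Being floating depends only on the component, so it passes from \<open>y\<close>
    to \<open>x\<close>.\<close>
  then have "conn A x z \<longleftrightarrow> conn A y z" for z by (meson conn_sym conn_trans)
  then show "floating_at A x" using y(2) by (simp add: floating_at_def)
qed

section \<open>Exchange of an edge between the two kinds of forests\<close>

text \<open>The edge hangs the floating component onto a component with a single vertex of
  \<open>S\<close>, which becomes the root of the union. From \<open>x\<close> that root is reached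
  only across \<open>e\<close>.\<close>

lemma attach_floating:
  assumes F: "floating_at F x" and x: "x \<in> V" and e: "e \<in> edge_boundary {y. conn F x y}"
  shows "insert e F \<in> \<F>\<^sub>1 V E S" "e \<notin> F" "sep e x (root (insert e F) x)"
proof -
  have FE: "F \<subseteq> E" and no: "\<And>s. s \<in> S \<Longrightarrow> \<not> conn F x s"
    and un: "\<And>y. y \<in> V \<Longrightarrow> \<not> conn F x y \<Longrightarrow> \<exists>!s. s \<in> S \<and> conn F y s"
    using F by (auto simp: floating_at_def)
  have eE: "e \<in> E" using e by (simp add: edge_boundary_def)
  then obtain p q where pq: "p \<in> V" "q \<in> V" "e = {p, q}" by (rule edgeE)
  \<comment> \<open>The edge is oriented with \<open>a\<close> in the floating component.\<close>
  obtain a b where ab: "a \<in> V" "b \<in> V" "e = {a, b}" "conn F x a" "\<not> conn F x b"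
    using that[of p q] that[of q p] pq e by (auto simp: edge_boundary_iff insert_commute)
  show eF: "e \<notin> F" using component_edge_boundary[OF _ FE] e by blast
  obtain r where r: "r \<in> S" "conn F b r"
    using un[OF ab(2,5)] by blast
  have "\<exists>!s. s \<in> S \<and> conn (insert e F) y s" if y: "y \<in> V" for y
  proof (cases "conn F x y")
    case True
    then have "s \<in> S \<and> conn (insert e F) y s \<longleftrightarrow> s \<in> S \<and> conn F b s" for s
      unfolding ab(3) conn_insert_iff using no ab(4,5) by (meson conn_sym conn_trans)
    then show ?thesis using un[OF ab(2,5)] by simp
  next
    case False
    then have "s \<in> S \<and> conn (insert e F) y s \<longleftrightarrow> s \<in> S \<and> conn F y s" for s
      unfolding ab(3) conn_insert_iff using no ab(4,5) by (meson conn_sym conn_trans)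
    then show ?thesis using un[OF y False] by simp
  qed
  then show T: "insert e F \<in> \<F>\<^sub>1 V E S" using FE eE by (simp add: rooted_forests_iff)
  have "conn (insert e F) x r" using ab r by (auto simp: conn_insert_iff)
  then have "root (insert e F) x = r" using root_eq[OF T x r(1)] by simp
  moreover have "conn (E - {e}) x a" "conn (E - {e}) b r"
    using FE eF ab(4) r(2) by (auto elim!: conn_mono[rotated])
  moreover have "\<not> conn (E - {e}) a b" using edge_nonconn[of "E - {e}" a b] eE ab by auto
  ultimately show "sep e x (root (insert e F) x)"
    unfolding sep_def by (metis conn_sym conn_trans)
qed

text \<open>Since \<open>T\<close> joins \<open>x\<close> to its root, it must contain the
  separating edge \<open>e\<close>. Deleting \<open>e\<close> cuts \<open>x\<close> off from the
  only vertex of \<open>S\<close> in its component, while the other piece keeps it.\<close>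

lemma detach_floating:
  assumes T: "T \<in> \<F>\<^sub>1 V E S" and x: "x \<in> V" and e: "e \<in> E" "sep e x (root T x)"
  shows "e \<in> T" "floating_at (T - {e}) x" "e \<in> edge_boundary {y. conn (T - {e}) x y}"
proof -
  let ?F = "T - {e}" and ?r = "root T x"
  have TE: "T \<subseteq> E" using T by (simp add: rooted_forests_iff)
  note r = root[OF T x]
  have FT: "conn T y z" if "conn ?F y z" for y z using that by (auto elim!: conn_mono[rotated])
  have nr: "\<not> conn ?F x ?r"
    using e(2) conn_mono[of ?F "E - {e}"] TE unfolding sep_def by blast
  show eT: "e \<in> T"
  proof (rule ccontr)
    assume "e \<notin> T"
    then have "?F = T" by simp
    then show False using nr r(2) by simp
  qed
  obtain p q where pq: "e = {p, q}" using e(1) by (rule edgeE)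
  have split: "conn ?F y z \<or> (conn ?F y p \<and> conn ?F q z) \<or> (conn ?F y q \<and> conn ?F p z)"
    if "conn T y z" for y z
    using that conn_insertD[of p q ?F y z] eT pq by (simp add: insert_absorb)
  obtain a b where ab: "e = {a, b}" "conn ?F x a" "conn ?F b ?r"
    using split[OF r(2)] nr pq that[of p q] that[of q p] by (auto simp: insert_commute)
  have split': "conn ?F y z \<or> (conn ?F y a \<and> conn ?F b z) \<or> (conn ?F y b \<and> conn ?F a z)"
    if "conn T y z" for y z
    using that conn_insertD[of a b ?F y z] eT ab(1) by (simp add: insert_absorb)
  have none: "\<not> conn ?F x s" if "s \<in> S" for s
    using root_eq[OF T x that FT] nr by blast
  have "\<exists>!s. s \<in> S \<and> conn ?F y s" if y: "y \<in> V" "\<not> conn ?F x y" for y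
  proof -
    have s: "root T y \<in> S" "conn T y (root T y)" using root[OF T y(1)] by auto
    \<comment> \<open>If the walk from \<open>y\<close> to its root needs \<open>e\<close>, then
      \<open>y\<close> is on the side of \<open>b\<close>, because the side of \<open>a\<close> is
      that of \<open>x\<close>; from \<open>b\<close> the root \<open>?r\<close> is reached without
      \<open>e\<close>.\<close>
    have "\<exists>s\<in>S. conn ?F y s"
      using split'[OF s(2)] s(1) r(1) ab y(2) by (meson conn_sym conn_trans)
    moreover have "s = t" if "s \<in> S" "t \<in> S" "conn ?F y s" "conn ?F y t" for s t
      using root_eq[OF T y(1)] that FT by metis
    ultimately show ?thesis by blast
  qed
  then have "\<forall>y\<in>V. conn ?F x y \<or> (\<exists>!s. s \<in> S \<and> conn ?F y s)" by blast
  moreover have "?F \<subseteq> E" using TE by blast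
  ultimately show "floating_at ?F x" using none by (simp add: floating_at_def)
  have "\<not> conn ?F x b" using nr ab(3) conn_trans by metis
  then show "e \<in> edge_boundary {y. conn ?F x y}"
    using ab e(1) by (simp add: edge_boundary_iff)
qed

lemma finite_forests: "finite (\<F>\<^sub>1 V E S)" "finite (\<F>\<^sub>2 V E S)" "finite {F. floating_at F x}"
proof -
  have "finite (Pow E)" using finite_E by simp
  then show "finite (\<F>\<^sub>1 V E S)" "finite (\<F>\<^sub>2 V E S)" "finite {F. floating_at F x}"
    by (rule finite_subset[rotated],
        auto simp: rooted_forests_iff floating_forests_iff floating_at_def)+
qed

lemma coweight_insert:
  assumes "e \<in> E" "e \<notin> A"
  shows "coweight E \<alpha> A = coweight E \<alpha> (insert e A) * \<alpha> e"
proof -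
  have "E - A = insert e (E - insert e A)" using assms by auto
  moreover have "prod \<alpha> (insert e (E - insert e A)) = \<alpha> e * prod \<alpha> (E - insert e A)"
    using finite_E by (intro prod.insert) auto
  ultimately show ?thesis unfolding coweight_def by (metis mult.commute)
qed

text \<open>By \<open>attach_floating\<close> and \<open>detach_floating\<close>, inserting and
  deleting \<open>e\<close> are mutually inverse on the pairs, and \<open>coweight_insert\<close>
  supplies the factor \<open>\<alpha> e\<close>. The weight \<open>c\<close> is left free to carry
  signs.\<close>

lemma exchange_sum:
  fixes c :: "'a set \<Rightarrow> real"
  assumes x: "x \<in> V"
  shows "(\<Sum>F | floating_at F x. coweight E \<alpha> F * (\<Sum>e\<in>edge_boundary {y. conn F x y}. c e)) =
    (\<Sum>T\<in>\<F>\<^sub>1 V E S. coweight E \<alpha> T * (\<Sum>e | e \<in> E \<and> sep e x (root T x). \<alpha> e * c e))"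
    (is "?L = ?R")
proof -
  let ?P = "SIGMA F:{F. floating_at F x}. edge_boundary {y. conn F x y}"
  let ?Q = "SIGMA T:\<F>\<^sub>1 V E S. {e \<in> E. sep e x (root T x)}"
  have fin: "finite (edge_boundary C)" for C using finite_E by (simp add: edge_boundary_def)
  have "?L = (\<Sum>(F, e)\<in>?P. coweight E \<alpha> F * c e)"
    using finite_forests fin by (simp add: sum_distrib_left sum.Sigma)
  also have "\<dots> = (\<Sum>(T, e)\<in>?Q. coweight E \<alpha> T * (\<alpha> e * c e))"
  proof (rule sum.reindex_bij_witness[of _ "\<lambda>(T, e). (T - {e}, e)" "\<lambda>(F, e). (insert e F, e)"])
    fix z assume "z \<in> ?P"
    then obtain F e where z: "z = (F, e)"
      and F: "floating_at F x" "e \<in> edge_boundary {y. conn F x y}" by auto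
    then have e: "e \<in> E" by (simp add: edge_boundary_def)
    note attach = attach_floating[OF F(1) x F(2)]
    show "(\<lambda>(T, e). (T - {e}, e)) ((\<lambda>(F, e). (insert e F, e)) z) = z"
      using attach by (simp add: z)
    show "(\<lambda>(F, e). (insert e F, e)) z \<in> ?Q"
      using attach e by (simp add: z)
    show "(case (\<lambda>(F, e). (insert e F, e)) z of (T, e) \<Rightarrow> coweight E \<alpha> T * (\<alpha> e * c e)) =
        (case z of (F, e) \<Rightarrow> coweight E \<alpha> F * c e)"
      using coweight_insert[OF e attach(2)] by (simp add: z)
  next
    fix z assume "z \<in> ?Q"
    then obtain T e where z: "z = (T, e)"
      and T: "T \<in> \<F>\<^sub>1 V E S" "e \<in> E" "sep e x (root T x)" by auto
    note detach = detach_floating[OF T(1) x T(2,3)]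
    show "(\<lambda>(F, e). (insert e F, e)) ((\<lambda>(T, e). (T - {e}, e)) z) = z"
      using detach by (auto simp: z)
    show "(\<lambda>(T, e). (T - {e}, e)) z \<in> ?P"
      using detach by (simp add: z)
  qed
  also have "\<dots> = ?R"
    using finite_forests finite_E by (simp add: sum_distrib_left sum.Sigma)
  finally show ?thesis .
qed

text \<open>As \<open>u\<close> is in \<open>S\<close>, it lies outside every floating component, so
  exactly one boundary edge separates \<open>x\<close> from \<open>u\<close>.\<close>

lemma floating_at_sum:
  assumes x: "x \<in> V" and u: "u \<in> S"
  shows "(\<Sum>F | floating_at F x. coweight E \<alpha> F * (2 - real (outdeg_floating V E S F))) =
    (\<Sum>T\<in>\<F>\<^sub>1 V E S. coweight E \<alpha> T *
      (tree_dist V E \<alpha> u x - tree_dist V E \<alpha> u (root T x)))"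
proof -
  \<comment> \<open>The sign is 1 if \<open>e\<close> separates \<open>x\<close> from
    \<open>u\<close> and -1 otherwise; over the boundary the signs add up to 2 minus its
    size.\<close>
  let ?c = "\<lambda>e. 2 * of_bool (sep e x u) - 1 :: real"
  have uV: "u \<in> V" using u S_subset by blast
  have "2 - real (outdeg_floating V E S F) = (\<Sum>e\<in>edge_boundary {y. conn F x y}. ?c e)"
    if F: "floating_at F x" for F
  proof -
    let ?B = "edge_boundary {y. conn F x y}"
    have fin: "finite ?B" using finite_E by (simp add: edge_boundary_def)
    have "\<exists>!e. e \<in> ?B \<and> sep e x u"
      using unique_separating_boundary_edge[of F x u] F x u uV by (auto simp: floating_at_def)
    then obtain e where "?B \<inter> {e. sep e x u} = {e}" by blast
    then have "(\<Sum>e\<in>?B. of_bool (sep e x u)) = (1::real)"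
      using fin by simp
    then have "(\<Sum>e\<in>?B. ?c e) = 2 - real (card ?B)"
      by (simp add: sum_subtractf sum_distrib_left[symmetric])
    then show ?thesis
      by (simp add: outdeg_floating_def boundary_size_eq floating_component_eq[OF F x])
  qed
  then have "(\<Sum>F | floating_at F x. coweight E \<alpha> F * (2 - real (outdeg_floating V E S F))) =
      (\<Sum>F | floating_at F x. coweight E \<alpha> F * (\<Sum>e\<in>edge_boundary {y. conn F x y}. ?c e))"
    by (intro sum.cong) auto
  also have "\<dots> = (\<Sum>T\<in>\<F>\<^sub>1 V E S. coweight E \<alpha> T *
      (\<Sum>e | e \<in> E \<and> sep e x (root T x). \<alpha> e * ?c e))"
    by (rule exchange_sum[OF x])
  also have "\<dots> = (\<Sum>T\<in>\<F>\<^sub>1 V E S. coweight E \<alpha> T *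
      (tree_dist V E \<alpha> u x - tree_dist V E \<alpha> u (root T x)))"
  proof (intro sum.cong refl arg_cong2[where f = "(*)"])
    fix T assume T: "T \<in> \<F>\<^sub>1 V E S"
    have rV: "root T x \<in> V" using root[OF T x] S_subset by blast
    \<comment> \<open>Among \<open>x\<close>, \<open>u\<close> and \<open>root T x\<close>, an edge
      splits off one vertex or none. If it separates \<open>x\<close> from the root, then
      \<open>u\<close> is on one of their two sides, and this decides the sign.\<close>
    have bits: "of_bool (sep e x (root T x)) * ?c e =
        of_bool (sep e u x) - of_bool (sep e u (root T x))" if "e \<in> E" for e
    proof -
      have "\<not> (sep e x (root T x) \<and> sep e x u \<and> sep e u (root T x))"
        using sep_two_sides[OF that x rV uV] by (auto simp: sep_sym)
      moreover have "sep e x (root T x) \<or> (sep e u x \<longleftrightarrow> sep e u (root T x))"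
        unfolding sep_def using conn_cong_right by metis
      moreover have "sep e x (root T x) \<Longrightarrow> sep e x u \<or> sep e u (root T x)"
        unfolding sep_def using conn_trans by metis
      ultimately show ?thesis by (auto simp: sep_sym[of e u x])
    qed
    have "(\<Sum>e | e \<in> E \<and> sep e x (root T x). \<alpha> e * ?c e) =
        (\<Sum>e\<in>E. \<alpha> e * (of_bool (sep e x (root T x)) * ?c e))"
      by (rule sum.mono_neutral_cong_left[OF finite_E]) auto
    also have "\<dots> = (\<Sum>e\<in>E. \<alpha> e * (of_bool (sep e u x) - of_bool (sep e u (root T x))))"
      by (intro sum.cong refl) (simp only: bits)
    also have "\<dots> = tree_dist V E \<alpha> u x - tree_dist V E \<alpha> u (root T x)"
      using uV x rV by (simp add: tree_dist_eq right_diff_distrib sum_subtractf)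
    finally show "(\<Sum>e | e \<in> E \<and> sep e x (root T x). \<alpha> e * ?c e) =
        tree_dist V E \<alpha> u x - tree_dist V E \<alpha> u (root T x)" .
  qed
  finally show ?thesis .
qed

section \<open>Regrouping by components, and the final summation\<close>

text \<open>The fibres of \<open>root T\<close> are the components of \<open>T\<close>, and the one
  over \<open>v\<close> has mass \<open>2 - outdeg(T, v)\<close>.\<close>

lemma sum_outdeg_eq_sum_vertex_mass:
  fixes g :: "'a \<Rightarrow> real"
  assumes T: "T \<in> \<F>\<^sub>1 V E S"
  shows "(\<Sum>v\<in>S. g v * (2 - real (outdeg V E T v))) = (\<Sum>x\<in>V. vertex_mass x * g (root T x))"
proof -
  have TE: "T \<subseteq> E" using T by (simp add: rooted_forests_iff)
  have finS: "finite S" using S_subset finite_V by (rule finite_subset)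
  have comp: "{x. conn T v x} = {x \<in> V. root T x = v}" if v: "v \<in> S" for v
  proof (intro set_eqI iffI)
    fix x assume "x \<in> {x. conn T v x}"
    then have x: "conn T v x" by simp
    moreover have "x \<in> V" using conn_in_V[OF TE x] v S_subset by blast
    ultimately show "x \<in> {x \<in> V. root T x = v}"
      using root_eq[OF T _ v conn_sym] by simp
  next
    fix x assume "x \<in> {x \<in> V. root T x = v}"
    then show "x \<in> {x. conn T v x}" using root(2)[OF T, of x] by (auto intro: conn_sym)
  qed
  have "g v * (2 - real (outdeg V E T v)) =
      (\<Sum>x | x \<in> V \<and> root T x = v. vertex_mass x * g (root T x))" if v: "v \<in> S" for v
  proof -
    have vV: "v \<in> V" using v S_subset by blast
    have "2 - real (outdeg V E T v) = (\<Sum>x | x \<in> V \<and> root T x = v. vertex_mass x)"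
      using sum_vertex_mass[OF TE vV] component_eq[OF TE vV] comp[OF v]
      by (simp add: outdeg_def)
    then show ?thesis by (simp add: sum_distrib_left mult.commute)
  qed
  then have "(\<Sum>v\<in>S. g v * (2 - real (outdeg V E T v))) =
      (\<Sum>v\<in>S. \<Sum>x | x \<in> V \<and> root T x = v. vertex_mass x * g (root T x))"
    by simp
  also have "\<dots> = (\<Sum>x\<in>V. vertex_mass x * g (root T x))"
    using root(1)[OF T] by (intro sum.group finite_V finS) auto
  finally show ?thesis .
qed

text \<open>One factor of the square is expanded as the mass of the floating component, and the two
  sums are exchanged.\<close>

lemma sum_floating_squares:
  "(\<Sum>F\<in>\<F>\<^sub>2 V E S. coweight E \<alpha> F * (2 - real (outdeg_floating V E S F))\<^sup>2) =
    (\<Sum>x\<in>V. vertex_mass x *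
      (\<Sum>F | floating_at F x. coweight E \<alpha> F * (2 - real (outdeg_floating V E S F))))"
proof -
  let ?h = "\<lambda>F. coweight E \<alpha> F * (2 - real (outdeg_floating V E S F))"
  have mass: "2 - real (outdeg_floating V E S F) =
      (\<Sum>x\<in>V. vertex_mass x * of_bool (floating_at F x))" if F: "F \<in> \<F>\<^sub>2 V E S" for F
  proof -
    obtain y where y: "y \<in> V" "floating_at F y" using F floating_forests_iff by blast
    then have FE: "F \<subseteq> E" by (simp add: floating_at_def)
    have "{x. conn F y x} = {x \<in> V. floating_at F x}"
      using floating_at_iff F floating_component_eq[OF y(2,1)] conn_in_V[OF FE _ y(1)] by auto
    then have "2 - real (outdeg_floating V E S F) = (\<Sum>x | x \<in> V \<and> floating_at F x. vertex_mass x)"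
      using sum_vertex_mass[OF FE y(1)]
      by (simp add: outdeg_floating_def floating_component_eq[OF y(2,1)])
    also have "\<dots> = (\<Sum>x\<in>V. vertex_mass x * of_bool (floating_at F x))"
      by (rule sum.mono_neutral_cong_left[OF finite_V]) auto
    finally show ?thesis .
  qed
  have "(\<Sum>F\<in>\<F>\<^sub>2 V E S. coweight E \<alpha> F * (2 - real (outdeg_floating V E S F))\<^sup>2) =
      (\<Sum>F\<in>\<F>\<^sub>2 V E S. ?h F * (\<Sum>x\<in>V. vertex_mass x * of_bool (floating_at F x)))"
    by (intro sum.cong refl) (simp add: mass[symmetric] power2_eq_square)
  also have "\<dots> = (\<Sum>F\<in>\<F>\<^sub>2 V E S. \<Sum>x\<in>V. vertex_mass x * (?h F * of_bool (floating_at F x)))"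
    by (simp add: sum_distrib_left mult_ac)
  also have "\<dots> = (\<Sum>x\<in>V. vertex_mass x * (\<Sum>F\<in>\<F>\<^sub>2 V E S. ?h F * of_bool (floating_at F x)))"
    by (subst sum.swap) (simp add: sum_distrib_left)
  also have "\<dots> = (\<Sum>x\<in>V. vertex_mass x * (\<Sum>F | floating_at F x. ?h F))"
  proof (intro sum.cong refl)
    fix x assume "x \<in> V"
    then have "(\<Sum>F\<in>\<F>\<^sub>2 V E S. ?h F * of_bool (floating_at F x)) = (\<Sum>F | floating_at F x. ?h F)"
      by (intro sum.mono_neutral_cong_right[OF finite_forests(2)]) (auto simp: floating_forests_iff)
    then show "vertex_mass x * (\<Sum>F\<in>\<F>\<^sub>2 V E S. ?h F * of_bool (floating_at F x)) =
        vertex_mass x * (\<Sum>F | floating_at F x. ?h F)"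
      by (rule arg_cong)
  qed
  finally show ?thesis .
qed

end

theorem theorem5p3:
  fixes V S :: "'a set" and E :: "'a set set" and \<alpha> :: "'a set \<Rightarrow> real"
    and m :: "'a \<Rightarrow> real" and lam :: real
  assumes tree: "finite_tree V E"
    and pos: "\<And>e. e \<in> E \<Longrightarrow> \<alpha> e > 0"
    and S: "S \<subseteq> V" "S \<noteq> {}"
    and m: "\<And>v. v \<in> S \<Longrightarrow>
      m v = (\<Sum>T\<in>\<F>\<^sub>1 V E S. coweight E \<alpha> T * (2 - real (outdeg V E T v)))"
    and lam: "lam = (\<Sum>e\<in>E. \<alpha> e) * (\<Sum>T\<in>\<F>\<^sub>1 V E S. coweight E \<alpha> T)
      - (\<Sum>F\<in>\<F>\<^sub>2 V E S. coweight E \<alpha> F * (2 - real (outdeg_floating V E S F))\<^sup>2)"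
  shows "\<forall>u\<in>S. (\<Sum>v\<in>S. tree_dist V E \<alpha> u v * m v) = lam"
proof
  fix u assume u: "u \<in> S"
  interpret rooted_tree_graph V E S using tree S(1) by unfold_locales
  let ?d = "tree_dist V E \<alpha> u" and ?w = "coweight E \<alpha>"
  have uV: "u \<in> V" using u S by blast
  have "(\<Sum>v\<in>S. ?d v * m v) =
      (\<Sum>v\<in>S. \<Sum>T\<in>\<F>\<^sub>1 V E S. ?w T * (?d v * (2 - real (outdeg V E T v))))"
    by (simp add: m sum_distrib_left mult.left_commute)
  also have "\<dots> = (\<Sum>T\<in>\<F>\<^sub>1 V E S. ?w T * (\<Sum>v\<in>S. ?d v * (2 - real (outdeg V E T v))))"
    by (subst sum.swap) (simp add: sum_distrib_left)
  also have "\<dots> = (\<Sum>T\<in>\<F>\<^sub>1 V E S. ?w T * (\<Sum>x\<in>V. vertex_mass x * ?d (root T x)))"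
    by (intro sum.cong refl) (simp only: sum_outdeg_eq_sum_vertex_mass)
  finally have Dm: "(\<Sum>v\<in>S. ?d v * m v) =
      (\<Sum>T\<in>\<F>\<^sub>1 V E S. ?w T * (\<Sum>x\<in>V. vertex_mass x * ?d (root T x)))" .
  \<comment> \<open>The quadratic sum is evaluated in terms of \<open>D[S] m\<close>, so that the
    claim follows by rearranging.\<close>
  have "(\<Sum>F\<in>\<F>\<^sub>2 V E S. ?w F * (2 - real (outdeg_floating V E S F))\<^sup>2) =
      (\<Sum>x\<in>V. vertex_mass x * (\<Sum>T\<in>\<F>\<^sub>1 V E S. ?w T * (?d x - ?d (root T x))))"
    unfolding sum_floating_squares using floating_at_sum[OF _ u] by simp
  also have "\<dots> = (\<Sum>x\<in>V. \<Sum>T\<in>\<F>\<^sub>1 V E S. ?w T * (vertex_mass x * (?d x - ?d (root T x))))"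
    by (simp add: sum_distrib_left mult.left_commute)
  also have "\<dots> = (\<Sum>T\<in>\<F>\<^sub>1 V E S. ?w T * (\<Sum>x\<in>V. vertex_mass x * (?d x - ?d (root T x))))"
    by (subst sum.swap) (simp add: sum_distrib_left)
  \<comment> \<open>The part with \<open>?d x\<close> does not depend on \<open>T\<close>: it is the
    total edge length.\<close>
  also have "\<dots> = (\<Sum>T\<in>\<F>\<^sub>1 V E S. ?w T *
      ((\<Sum>e\<in>E. \<alpha> e) - (\<Sum>x\<in>V. vertex_mass x * ?d (root T x))))"
    by (simp add: right_diff_distrib[of "vertex_mass _"] sum_subtractf sum_vertex_mass_dist[OF uV])
  also have "\<dots> = (\<Sum>e\<in>E. \<alpha> e) * (\<Sum>T\<in>\<F>\<^sub>1 V E S. ?w T) - (\<Sum>v\<in>S. ?d v * m v)"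
    unfolding Dm
    by (simp only: right_diff_distrib sum_subtractf sum_distrib_right[symmetric]
        mult.commute[of "sum \<alpha> E"])
  finally show "(\<Sum>v\<in>S. ?d v * m v) = lam"
    by (simp add: lam)
qed

end
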